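(* Let $(M,\delta)$ be a metric space, and let $\mathrm{der}(M)$ denote the set of all limit points of $M$. If $\mathrm{der}(M)$ is compact, then there exists a distance function (metric) $d$ on $M$ such that: (i) $(M,d)$ is uniformly continuous, i.e. every continuous function $f:(M,d)\to\mathbb{R}$ is uniformly continuous with respect to $d$; (ii) $(M,\delta)$ and $(M,d)$ have the same open sets.
   Context: A metric space $(M,d)$ is called uniformly continuous if every real-valued continuous function on $M$ is uniformly continuous ($\mathbb{R}$ carries its usual metric). The derived set $\mathrm{der}(M)$ is the set of all limit points of $M$, i.e. the points $x\in M$ such that every open neighborhood of $x$ contains a point of $M$ other than $x$. The empty set counts as compact. *)

theory Defs
  imports "HOL-Analysis.Analysis"
begin

definition uniformly_continuous_metric :: "'a metric \<Rightarrow> bool" where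
  "uniformly_continuous_metric m \<longleftrightarrow>
     (\<forall>f :: 'a \<Rightarrow> real. continuous_map (mtopology_of m) euclideanreal f
        \<longrightarrow> uniformly_continuous_map m euclidean_metric f)"

end

theory Submission
  imports Defs
begin

text \<open>
  Let \<open>K\<close> be the derived set and let \<open>h\<close> be the distance to \<open>K\<close>, capped at 1. Adding \<open>max (h x) (h y)\<close>
  to the distance of distinct points keeps the topology: nothing essential changes at points of \<open>K\<close>,
  where \<open>h\<close> vanishes, and the points outside \<open>K\<close> are isolated in both metrics. In the new metric two
  distinct points can only be close to each other near \<open>K\<close>, and there a continuous function has
  small oscillation at a uniform scale by Lebesgue's number lemma.
\<close>

context Metric_space
begin

text \<open>Inserting 1 keeps the infimum over a nonempty set when \<open>K\<close> is empty; the
  value is then 1 everywhere, so an empty derived set needs no separate case.\<close>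

definition capped_setdist :: "'a set \<Rightarrow> 'a \<Rightarrow> real" where
  "capped_setdist K x = Inf (insert 1 (d x ` K))"

definition spread_dist :: "('a \<Rightarrow> real) \<Rightarrow> 'a \<Rightarrow> 'a \<Rightarrow> real" where
  "spread_dist h x y = (if x = y then 0 else d x y + max (h x) (h y))"

lemma bdd_below_capped_dists: "bdd_below (insert 1 (d x ` K))"
  by (rule bdd_belowI [where m = 0]) auto

lemma capped_setdist_nonneg: "0 \<le> capped_setdist K x"
  unfolding capped_setdist_def by (rule cInf_greatest) auto

lemma capped_setdist_le: "k \<in> K \<Longrightarrow> capped_setdist K x \<le> d x k"
  unfolding capped_setdist_def by (rule cInf_lower [OF _ bdd_below_capped_dists]) auto

text \<open>The bound \<open>r \<le> 1\<close> prevents the inserted 1 from being the element below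
  \<open>r\<close>, so that element is a genuine distance to a point of \<open>K\<close>.\<close>

lemma capped_setdist_lessE:
  assumes "capped_setdist K x < r" "r \<le> 1"
  obtains k where "k \<in> K" "d x k < r"
proof -
  obtain t where "t \<in> insert 1 (d x ` K)" "t < r"
    using assms cInf_lessD [of "insert 1 (d x ` K)" r] unfolding capped_setdist_def by auto
  then show thesis
    using assms that by auto
qed

lemma capped_setdist_eq_0: "x \<in> M \<Longrightarrow> x \<in> K \<Longrightarrow> capped_setdist K x = 0"
  using capped_setdist_le [of x K x] capped_setdist_nonneg [of K x] by simp

text \<open>A point outside the derived set has an open singleton, hence a ball of some radius
  \<open>r\<close> containing no other point. A limit point closer than \<open>r\<close> would have
  to be \<open>x\<close> itself, so the capped distance is at least \<open>min 1 r\<close>.\<close>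

lemma capped_setdist_derived_set_pos:
  assumes "x \<in> M" "x \<notin> mtopology derived_set_of M"
  shows "0 < capped_setdist (mtopology derived_set_of M) x"
proof -
  have "openin mtopology {x}"
    using assms derived_set_of_topspace [of mtopology] by simp
  then obtain r where r: "r > 0" "mball x r \<subseteq> {x}"
    by (auto simp: openin_mtopology)
  have K: "mtopology derived_set_of M \<subseteq> M"
    using derived_set_of_subset_topspace [of mtopology M] by simp
  have "min 1 r \<le> capped_setdist (mtopology derived_set_of M) x"
  proof (rule ccontr)
    assume "\<not> ?thesis"
    then obtain k where k: "k \<in> mtopology derived_set_of M" "d x k < min 1 r"
      using capped_setdist_lessE by (metis min.cobounded1 not_le)
    then have "k \<in> mball x r"
      using K assms by auto
    then show False
      using r k assms by auto
  qed
  then show ?thesis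
    using r by linarith
qed

text \<open>For the triangle inequality, \<open>max (h x) (h z)\<close> is at most
  \<open>max (h x) (h y) + max (h y) (h z)\<close> because \<open>h\<close> is nonnegative;
  coinciding points are handled by cases.\<close>

lemma Metric_space_spread_dist:
  assumes "\<And>x. 0 \<le> h x"
  shows "Metric_space M (spread_dist h)"
proof
  fix x y
  show "0 \<le> spread_dist h x y"
    using assms [of x] by (simp add: spread_dist_def add_nonneg_nonneg max.coboundedI1)
  show "spread_dist h x y = spread_dist h y x"
    by (simp add: spread_dist_def commute max.commute)
next
  fix x y
  assume xy: "x \<in> M" "y \<in> M"
  show "spread_dist h x y = 0 \<longleftrightarrow> x = y"
    using mdist_pos_eq [OF xy] assms [of x] by (auto simp: spread_dist_def)
next
  fix x y z
  assume "x \<in> M" "y \<in> M" "z \<in> M"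
  then have "d x z \<le> d x y + d y z"
    by (rule triangle)
  then show "spread_dist h x z \<le> spread_dist h x y + spread_dist h y z"
    using assms [of x] assms [of y] assms [of z] nonneg [of x y] nonneg [of y z]
    by (auto simp: spread_dist_def commute)
qed

text \<open>The new distance dominates \<open>d\<close>, so its topology is at least as fine.
  Conversely, at a limit point half the radius suffices by the factor 2 in \<open>limit\<close>, and
  any other point already has an open singleton for \<open>d\<close>.\<close>

lemma mtopology_spread_dist:
  assumes nonneg_h: "\<And>x. 0 \<le> h x"
    and limit: "\<And>x y. \<lbrakk>x \<in> mtopology derived_set_of M; y \<in> M\<rbrakk> \<Longrightarrow> spread_dist h x y \<le> 2 * d x y"
    and isolated: "\<And>x. \<lbrakk>x \<in> M; x \<notin> mtopology derived_set_of M\<rbrakk> \<Longrightarrow> 0 < h x"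
  shows "Metric_space.mtopology M (spread_dist h) = mtopology"
proof -
  interpret S: Metric_space M "spread_dist h"
    by (rule Metric_space_spread_dist [OF nonneg_h])
  have ge: "d x y \<le> spread_dist h x y" if "x \<in> M" for x y
    using nonneg_h [of x] that by (auto simp: spread_dist_def)
  have "openin S.mtopology U" if "openin mtopology U" for U
  proof -
    have "S.mball x r \<subseteq> mball x r" for x r
      using ge [of x] by (auto simp: S.in_mball) (meson le_less_trans)
    then show ?thesis
      using that unfolding openin_mtopology S.openin_mtopology by (meson subset_trans)
  qed
  moreover have "openin mtopology U" if U: "openin S.mtopology U" for U
    unfolding openin_mtopology
  proof (intro conjI allI impI)
    show "U \<subseteq> M"
      using U by (simp add: S.openin_mtopology)
    fix x
    assume x: "x \<in> U"
    then have xM: "x \<in> M"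
      using \<open>U \<subseteq> M\<close> by auto
    show "\<exists>r>0. mball x r \<subseteq> U"
    proof (cases "x \<in> mtopology derived_set_of M")
      case True
      obtain r where r: "r > 0" "S.mball x r \<subseteq> U"
        using U x by (auto simp: S.openin_mtopology)
      have "mball x (r/2) \<subseteq> S.mball x r"
        using limit [OF True] by (fastforce simp: S.in_mball)
      with r show ?thesis
        by (meson half_gt_zero subset_trans)
    next
      case False
      then have "openin mtopology {x}"
        using xM derived_set_of_topspace [of mtopology] by simp
      then show ?thesis
        using x unfolding openin_mtopology by (metis insertI1 empty_subsetI insert_subset subset_trans)
    qed
  qed
  ultimately show ?thesis
    by (auto simp: topology_eq)
qed

end

text \<open>Compactness of \<open>K\<close> gives a Lebesgue number \<open>e\<close> for a cover of
  \<open>K\<close> by open sets on which \<open>f\<close> varies by less than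
  \<open>\<epsilon>\<close>. By \<open>spread\<close>, two distinct points that are close enough
  share a ball of radius \<open>e\<close> about a point of \<open>K\<close>, hence share a member of
  the cover.\<close>

lemma (in Metric_space) uniformly_continuous_metric_spread:
  assumes K: "compactin mtopology K"
    and spread: "\<And>e. 0 < e \<Longrightarrow>
      \<exists>r>0. \<forall>x\<in>M. \<forall>y\<in>M. x \<noteq> y \<longrightarrow> d x y < r \<longrightarrow> (\<exists>k\<in>K. d k x < e \<and> d k y < e)"
  shows "uniformly_continuous_metric (metric (M, d))"
  unfolding uniformly_continuous_metric_def uniformly_continuous_map_def
proof (intro allI impI conjI)
  fix f :: "'a \<Rightarrow> real" and \<epsilon> :: real
  assume "continuous_map (mtopology_of (metric (M, d))) euclideanreal f" and \<epsilon>: "0 < \<epsilon>"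
  then have f: "continuous_map mtopology euclideanreal f"
    by simp
  define \<C> where "\<C> = {U. openin mtopology U \<and> (\<forall>x\<in>U. \<forall>y\<in>U. dist (f x) (f y) < \<epsilon>)}"
  have "K \<subseteq> \<Union>\<C>"
  proof
    fix k
    assume "k \<in> K"
    then have k: "k \<in> M"
      using K compactin_subset_topspace by fastforce
    let ?U = "{x \<in> topspace mtopology. f x \<in> ball (f k) (\<epsilon>/2)}"
    have "openin mtopology ?U"
      by (rule openin_continuous_map_preimage [OF f]) simp
    moreover have "\<forall>x\<in>?U. \<forall>y\<in>?U. dist (f x) (f y) < \<epsilon>"
      by (auto intro: dist_triangle_half_r [of "f k"])
    ultimately show "k \<in> \<Union>\<C>"
      unfolding \<C>_def using k \<epsilon> by (intro UnionI [where X = ?U]) auto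
  qed
  then obtain e where e: "e > 0" and leb: "\<And>k. k \<in> K \<Longrightarrow> \<exists>U\<in>\<C>. mball k e \<subseteq> U"
    using lebesgue_number [OF K, of \<C>] unfolding \<C>_def by blast
  obtain r where r: "r > 0"
    and near: "\<And>x y. \<lbrakk>x \<in> M; y \<in> M; x \<noteq> y; d x y < r\<rbrakk> \<Longrightarrow> \<exists>k\<in>K. d k x < e \<and> d k y < e"
    using spread [OF e] by blast
  have "dist (f y) (f x) < \<epsilon>" if xy: "x \<in> M" "y \<in> M" "d y x < r" for x y
  proof (cases "x = y")
    case False
    then obtain k where k: "k \<in> K" "d k y < e" "d k x < e"
      using near [of y x] xy by auto
    then have "k \<in> M"
      using K compactin_subset_topspace by fastforce
    then have "x \<in> mball k e" "y \<in> mball k e"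
      using k xy by auto
    then show ?thesis
      using leb [OF \<open>k \<in> K\<close>] unfolding \<C>_def by blast
  qed (use \<epsilon> in simp)
  with r show "\<exists>\<delta>>0. \<forall>x\<in>mspace (metric (M, d)). \<forall>y\<in>mspace (metric (M, d)).
      mdist (metric (M, d)) y x < \<delta> \<longrightarrow> mdist euclidean_metric (f y) (f x) < \<epsilon>"
    by auto
qed auto

theorem theorem2:
  fixes M :: "'a set" and \<delta> :: "'a \<Rightarrow> 'a \<Rightarrow> real"
  assumes "Metric_space M \<delta>"
    and "compactin (Metric_space.mtopology M \<delta>) (Metric_space.mtopology M \<delta> derived_set_of M)"
  shows "\<exists>d :: 'a \<Rightarrow> 'a \<Rightarrow> real.
           Metric_space M d
         \<and> uniformly_continuous_metric (metric (M, d))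
         \<and> (\<forall>U. openin (Metric_space.mtopology M \<delta>) U \<longleftrightarrow> openin (Metric_space.mtopology M d) U)"
proof -
  interpret Metric_space M \<delta>
    by (rule assms)
  define K where "K = mtopology derived_set_of M"
  define h where "h = capped_setdist K"
  have KM: "K \<subseteq> M"
    using derived_set_of_subset_topspace [of mtopology M] by (simp add: K_def)
  have h_nonneg: "0 \<le> h x" for x
    by (simp add: h_def capped_setdist_nonneg)
  interpret S: Metric_space M "spread_dist h"
    by (rule Metric_space_spread_dist [OF h_nonneg])
  \<comment> \<open>At a point of \<open>K\<close> the added term reduces to \<open>h x\<close>,
    which is itself bounded by the distance from \<open>x\<close> to \<open>k\<close>.\<close>
  have limit: "spread_dist h k x \<le> 2 * \<delta> k x" if "k \<in> K" "x \<in> M" for k x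
  proof -
    have "h k = 0" "h x \<le> \<delta> x k"
      using that KM capped_setdist_eq_0 capped_setdist_le by (auto simp: h_def)
    then show ?thesis
      using h_nonneg [of x] by (auto simp: spread_dist_def commute)
  qed
  have top: "S.mtopology = mtopology"
  proof (rule mtopology_spread_dist [OF h_nonneg])
    show "0 < h x" if "x \<in> M" "x \<notin> mtopology derived_set_of M" for x
      using that capped_setdist_derived_set_pos by (simp add: h_def K_def)
  qed (use limit K_def in auto)
  have "uniformly_continuous_metric (metric (M, spread_dist h))"
  proof (rule S.uniformly_continuous_metric_spread)
    \<comment> \<open>Compactness depends only on the topology, so it passes from
      \<open>\<delta>\<close> to the new metric.\<close>
    show "compactin S.mtopology K"
      using assms(2) by (simp add: top K_def)
    fix e :: real
    assume e: "0 < e"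
    \<comment> \<open>The 1 respects the cap on \<open>h\<close>; \<open>e/4\<close> leaves room for
      the bounds \<open>2 * r\<close> at \<open>x\<close> and \<open>3 * r\<close> at
      \<open>y\<close> obtained below.\<close>
    define r where "r = min 1 (e/4)"
    have r: "0 < r" "r \<le> 1" "4 * r \<le> e"
      using e by (auto simp: r_def)
    have "\<exists>k\<in>K. spread_dist h k x < e \<and> spread_dist h k y < e"
      if xy: "x \<in> M" "y \<in> M" "x \<noteq> y" "spread_dist h x y < r" for x y
    proof -
      \<comment> \<open>Since the points differ, the added term is present and forces
        \<open>x\<close> to lie near \<open>K\<close>.\<close>
      have "\<delta> x y + max (h x) (h y) < r"
        using xy by (simp add: spread_dist_def)
      then have "h x < r"
        using nonneg [of x y] by linarith
      then obtain k where k: "k \<in> K" "\<delta> x k < r"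
        unfolding h_def using capped_setdist_lessE r by metis
      then have "spread_dist h k x < 2 * r"
        using limit [of k x] xy by (simp add: commute)
      moreover have "spread_dist h k y \<le> spread_dist h k x + spread_dist h x y"
        using S.triangle k KM xy by auto
      ultimately show ?thesis
        using xy k r by (intro bexI [of _ k]) auto
    qed
    with r show "\<exists>r>0. \<forall>x\<in>M. \<forall>y\<in>M. x \<noteq> y \<longrightarrow> spread_dist h x y < r \<longrightarrow>
        (\<exists>k\<in>K. spread_dist h k x < e \<and> spread_dist h k y < e)"
      by blast
  qed
  then show ?thesis
    using S.Metric_space_axioms top by auto
qed

end
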